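(* For every integer $p\ge 1$ there exist a positive integer $k$ and a $k$-colorable ($2K_2$, $4K_1$, co-diamond, co-claw)-free graph that is not $(k+p)$-mixing.
   Context: All graphs are finite and simple. A $k$-coloring of $G$ is a map $V(G)\to\{1,\dots,k\}$ giving adjacent vertices different values; $G$ is $k$-colorable if it has a $k$-coloring. $R_k(G)$ denotes the graph whose vertices are the $k$-colorings of $G$, two being adjacent if they differ in color on exactly one vertex. $G$ is $\ell$-mixing if $R_\ell(G)$ is connected. A graph is $(H_1,\dots,H_r)$-free if it has no induced subgraph isomorphic to any $H_i$. $2K_2$ is the disjoint union of two edges; $4K_1$ is the edgeless graph on 4 vertices; the co-diamond is $K_2+2K_1$ (4 vertices, one edge); the co-claw is $K_3+K_1$ (disjoint union of a triangle and a single vertex). *)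

theory Defs
  imports Graph_Theory.Graph_Theory "HOL-Library.FuncSet"
begin

text \<open>Finite simple graphs are the graphs of the locale \<open>pair_graph\<close>: finite, symmetric and
  loopfree sets of pairs on a set of vertices.\<close>

definition colorings :: "nat \<Rightarrow> 'a pair_pre_digraph \<Rightarrow> ('a \<Rightarrow> nat) set" where
  "colorings k G = {c \<in> pverts G \<rightarrow>\<^sub>E {1..k}. \<forall>(u, v) \<in> parcs G. c u \<noteq> c v}"

definition colorable :: "nat \<Rightarrow> 'a pair_pre_digraph \<Rightarrow> bool" where
  "colorable k G \<longleftrightarrow> colorings k G \<noteq> {}"

definition recoloring_graph :: "nat \<Rightarrow> 'a pair_pre_digraph \<Rightarrow> ('a \<Rightarrow> nat) pair_pre_digraph" where
  "recoloring_graph k G =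
    \<lparr> pverts = colorings k G,
      parcs = {(c, d). c \<in> colorings k G \<and> d \<in> colorings k G \<and> (\<exists>!v. v \<in> pverts G \<and> c v \<noteq> d v)} \<rparr>"

text \<open>The library's \<^const>\<open>connected\<close> excludes the graph without vertices, so a graph that is mixing
  with \<open>l\<close> colors is in particular \<open>l\<close>-colorable.\<close>

definition mixing :: "nat \<Rightarrow> 'a pair_pre_digraph \<Rightarrow> bool" where
  "mixing l G \<longleftrightarrow> connected (with_proj (recoloring_graph l G))"

definition induced_free :: "'b pair_pre_digraph set \<Rightarrow> 'a pair_pre_digraph \<Rightarrow> bool" where
  "induced_free Hs G \<longleftrightarrow>
    (\<forall>H \<in> Hs. \<not> (\<exists>K. induced_subgraph K (with_proj G) \<and> digraph_iso K (with_proj H)))"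

definition graph_of_edges :: "nat \<Rightarrow> (nat \<times> nat) set \<Rightarrow> nat pair_pre_digraph" where
  "graph_of_edges n E = \<lparr> pverts = {..<n}, parcs = symcl E \<rparr>"

definition two_K2 :: "nat pair_pre_digraph" where
  "two_K2 = graph_of_edges 4 {(0, 1), (2, 3)}"

definition four_K1 :: "nat pair_pre_digraph" where
  "four_K1 = graph_of_edges 4 {}"

definition co_diamond :: "nat pair_pre_digraph" where
  "co_diamond = graph_of_edges 4 {(0, 1)}"

definition co_claw :: "nat pair_pre_digraph" where
  "co_claw = graph_of_edges 4 {(0, 1), (1, 2), (0, 2)}"

lemma pair_graph_forbidden:
  "pair_graph two_K2" "pair_graph four_K1" "pair_graph co_diamond" "pair_graph co_claw"
  unfolding two_K2_def four_K1_def co_diamond_def co_claw_def graph_of_edges_def symcl_def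
  by (unfold_locales; auto simp: symmetric_def intro!: symI)+

lemma pair_bidirected_digraph_recoloring_graph: "pair_bidirected_digraph (recoloring_graph k G)"
proof
  show "symmetric (with_proj (recoloring_graph k G))"
    unfolding symmetric_def by (auto simp: recoloring_graph_def eq_commute intro!: symI)
qed (auto simp: recoloring_graph_def)

lemma mixing_iff:
  "mixing l G \<longleftrightarrow> colorings l G \<noteq> {} \<and>
    (\<forall>c \<in> colorings l G. \<forall>d \<in> colorings l G. (c, d) \<in> (parcs (recoloring_graph l G))\<^sup>*)"
proof -
  let ?R = "recoloring_graph l G"
  interpret R: pair_bidirected_digraph ?R
    by (rule pair_bidirected_digraph_recoloring_graph)
  have ends: "x \<in> pverts ?R \<and> y \<in> pverts ?R" if "(x, y) \<in> parcs ?R" for x y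
    using that by (auto simp: recoloring_graph_def)
  have sym: "mk_symmetric (with_proj ?R) = ?R"
    by (rule pair_pre_digraph.equality)
      (auto simp: mk_symmetric_def intro: R.arcs_symmetric)
  have reach: "(c, d) \<in> rtrancl_on (pverts ?R) (parcs ?R) \<longleftrightarrow> (c, d) \<in> (parcs ?R)\<^sup>*"
    if "c \<in> pverts ?R" for c d
  proof
    assume "(c, d) \<in> (parcs ?R)\<^sup>*"
    then show "(c, d) \<in> rtrancl_on (pverts ?R) (parcs ?R)"
      by induct (use that ends in \<open>auto intro: rtrancl_on_into_rtrancl_on\<close>)
  qed (rule rtrancl_on_rtranclI)
  have verts: "pverts ?R = colorings l G"
    by (simp add: recoloring_graph_def)
  show ?thesis
    unfolding mixing_def connected_def sym strongly_connected_def reachable_def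
    using reach unfolding verts by (auto simp: verts)
qed

end

theory Submission
  imports Defs
begin

text \<open>Let \<open>Q\<close> be a simple graph with \<open>n\<close> vertices, \<open>n + p\<close> edges and maximum degree at most 3. On the
  pairs of a vertex and an edge at it, consider the map \<open>a\<close> to the vertex and the map \<open>b\<close> to the
  edge, and join two pairs if both maps separate them. The complement of this graph is the line graph
  of the subdivision of \<open>Q\<close>; since it is a line graph of a bipartite graph of maximum degree 3
  without 4-cycles, it contains no claw, no diamond, no \<open>K\<^sub>4\<close> and no induced 4-cycle. The map \<open>a\<close> is
  an \<open>n\<close>-coloring. The map \<open>b\<close> is a coloring with \<open>n + p\<close> colors in which no vertex can change its
  color: the two ends of another edge cannot both agree with the given pair under \<open>a\<close>. So \<open>b\<close> is
  isolated among the \<open>(n + p)\<close>-colorings. For \<open>Q\<close> we take \<open>p\<close> disjoint copies of \<open>K\<^sub>4\<close> minus an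
  edge.\<close>

section \<open>Graphs defined by two separating maps\<close>

definition separation_graph :: "'a set \<Rightarrow> ('a \<Rightarrow> 'b) \<Rightarrow> ('a \<Rightarrow> 'c) \<Rightarrow> 'a pair_pre_digraph" where
  "separation_graph V a b =
    \<lparr> pverts = V, parcs = {(x, y). x \<in> V \<and> y \<in> V \<and> a x \<noteq> a y \<and> b x \<noteq> b y} \<rparr>"

lemma pverts_separation_graph [simp]: "pverts (separation_graph V a b) = V"
  by (simp add: separation_graph_def)

lemma in_parcs_separation_graph [simp]:
  "(x, y) \<in> parcs (separation_graph V a b) \<longleftrightarrow> x \<in> V \<and> y \<in> V \<and> a x \<noteq> a y \<and> b x \<noteq> b y"
  by (simp add: separation_graph_def)

lemma pair_graph_separation_graph:
  assumes "finite V"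
  shows "pair_graph (separation_graph V a b)"
proof
  show "finite (parcs (separation_graph V a b))"
    by (rule finite_subset[of _ "V \<times> V"]) (use assms in \<open>auto simp: separation_graph_def\<close>)
  show "symmetric (with_proj (separation_graph V a b))"
    unfolding symmetric_def by (auto intro!: symI)
qed (use assms in \<open>auto simp: separation_graph_def\<close>)

text \<open>Adjacent vertices are separated by both maps; \<open>restrict\<close> provides the
  extensionality that \<open>colorings\<close> demands.\<close>

lemma restrict_in_colorings_separation_graph:
  assumes "c = a \<or> c = b" and "c ` V \<subseteq> {1..k}"
  shows "restrict c V \<in> colorings k (separation_graph V a b)"
  using assms by (auto simp: colorings_def)

section \<open>Forbidden induced subgraphs\<close>

lemma induced_copy_embedding:
  assumes "induced_subgraph K (with_proj G)" and "digraph_iso K (with_proj H)"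
  obtains g where "inj_on g (pverts H)" "g ` pverts H \<subseteq> pverts G"
    "\<And>u v. u \<in> pverts H \<Longrightarrow> v \<in> pverts H \<Longrightarrow> (g u, g v) \<in> parcs G \<longleftrightarrow> (u, v) \<in> parcs H"
proof -
  obtain f where iso: "pre_digraph.digraph_isomorphism K f" and H: "with_proj H = app_iso f K"
    using assms(2) by (auto simp: digraph_iso_def)
  have wf: "wf_digraph K"
    using iso by (simp add: pre_digraph.digraph_isomorphism_def)
  have inj: "inj_on (iso_verts f) (verts K)"
    using iso by (simp add: pre_digraph.digraph_isomorphism_def)
  have vH: "pverts H = iso_verts f ` verts K"
    using arg_cong[OF H, of verts] by simp
  \<comment> \<open>The isomorphism may also rename arcs; \<open>arcs_ends\<close> forgets their
    names and leaves only the vertex map.\<close>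
  have aH: "parcs H = (\<lambda>(u, v). (iso_verts f u, iso_verts f v)) ` arcs_ends K"
    using arg_cong[OF H, of arcs_ends] wf_digraph.arcs_ends_app_iso_eq[OF wf iso] by simp
  have sub: "verts K \<subseteq> pverts G" and tail: "tail K = fst" and head: "head K = snd"
    and arcs: "arcs K = {e \<in> parcs G. fst e \<in> verts K \<and> snd e \<in> verts K}"
    using assms(1) by (auto simp: induced_subgraph_def subgraph_def compatible_def)
  have ends: "arcs_ends K = {e \<in> parcs G. fst e \<in> verts K \<and> snd e \<in> verts K}"
    by (simp add: arcs_ends_conv tail head arcs)
  let ?g = "the_inv_into (verts K) (iso_verts f)"
  have g: "?g (iso_verts f x) = x" if "x \<in> verts K" for x
    using that by (simp add: the_inv_into_f_f[OF inj])
  show thesis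
  proof
    show "inj_on ?g (pverts H)"
      unfolding vH by (rule inj_on_the_inv_into[OF inj])
    show "?g ` pverts H \<subseteq> pverts G"
      using sub g by (auto simp: vH)
    fix u v assume "u \<in> pverts H" "v \<in> pverts H"
    then obtain x y where xy: "x \<in> verts K" "y \<in> verts K" "u = iso_verts f x" "v = iso_verts f y"
      by (auto simp: vH)
    have "(u, v) \<in> parcs H \<longleftrightarrow> (x, y) \<in> arcs_ends K"
      using xy by (auto simp: aH ends dest!: inj_onD[OF inj])
    then show "(?g u, ?g v) \<in> parcs G \<longleftrightarrow> (u, v) \<in> parcs H"
      using xy by (auto simp: ends g)
  qed
qed

lemma induced_copy_four:
  assumes "induced_subgraph K (with_proj G)" and "digraph_iso K (with_proj (graph_of_edges 4 E))"
  obtains g where "distinct [g 0, g 1, g 2, g 3]" "{g 0, g 1, g 2, g 3} \<subseteq> pverts G"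
    "\<forall>i<4. \<forall>j<4. (g i, g j) \<in> parcs G \<longleftrightarrow> (i, j) \<in> E \<or> (j, i) \<in> E"
proof -
  obtain g where g: "inj_on g {..<4::nat}" "g ` {..<4} \<subseteq> pverts G"
    "\<And>i j. i < 4 \<Longrightarrow> j < 4 \<Longrightarrow> (g i, g j) \<in> parcs G \<longleftrightarrow> (i, j) \<in> symcl E"
    using induced_copy_embedding[OF assms] by (auto simp: graph_of_edges_def)
  show thesis
  proof
    show "distinct [g 0, g 1, g 2, g 3]"
      using g(1) by (auto simp: inj_on_eq_iff)
    show "{g 0, g 1, g 2, g 3} \<subseteq> pverts G"
      using g(2) by auto
    show "\<forall>i<4. \<forall>j<4. (g i, g j) \<in> parcs G \<longleftrightarrow> (i, j) \<in> E \<or> (j, i) \<in> E"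
      using g(3) by (auto simp: symcl_def)
  qed
qed

text \<open>In the complement the four graphs become the 4-cycle, \<open>K_4\<close>, the diamond
  and the claw. With vertices read as edges between values of \<open>a\<close> and values of
  \<open>b\<close>, \<open>sep\<close> excludes multiple edges, \<open>b2\<close> and
  \<open>a3\<close> bound the degrees by 2 and 3, and \<open>simple\<close> excludes
  4-cycles.\<close>

lemma induced_free_separation_graph:
  assumes sep: "\<And>x y. x \<in> V \<Longrightarrow> y \<in> V \<Longrightarrow> a x = a y \<Longrightarrow> b x = b y \<Longrightarrow> x = y"
    and b2: "\<And>x y z. {x, y, z} \<subseteq> V \<Longrightarrow> b x = b y \<Longrightarrow> b x = b z \<Longrightarrow> \<not> distinct [x, y, z]"
    and a3: "\<And>w x y z. {w, x, y, z} \<subseteq> V \<Longrightarrow> a w = a x \<Longrightarrow> a w = a y \<Longrightarrow> a w = a z \<Longrightarrow>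
      \<not> distinct [w, x, y, z]"
    and simple: "\<And>w x y z. {w, x, y, z} \<subseteq> V \<Longrightarrow> a w = a x \<Longrightarrow> b x = b y \<Longrightarrow> a y = a z \<Longrightarrow> b z = b w \<Longrightarrow>
      \<not> distinct [w, x, y, z]"
  shows "induced_free {two_K2, four_K1, co_diamond, co_claw} (separation_graph V a b)"
proof -
  let ?G = "separation_graph V a b"
  \<comment> \<open>A triangle in the line graph of a bipartite graph is a star, here at a value of \<open>a\<close>.\<close>
  have triangle: "a x = a y \<and> a x = a z"
    if "{x, y, z} \<subseteq> V" "distinct [x, y, z]" "a x = a y \<or> b x = b y" "a x = a z \<or> b x = b z"
      "a y = a z \<or> b y = b z" for x y z
    using that sep[of x y] sep[of x z] sep[of y z] b2[of x y z] by auto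
  have "\<not> (induced_subgraph K (with_proj ?G) \<and> digraph_iso K (with_proj H))"
    if "H \<in> {two_K2, four_K1, co_diamond, co_claw}" for H :: "nat pair_pre_digraph" and K
  proof
    assume "induced_subgraph K (with_proj ?G) \<and> digraph_iso K (with_proj H)"
    then have sub: "induced_subgraph K (with_proj ?G)" and iso: "digraph_iso K (with_proj H)"
      by simp_all
    consider "H = two_K2" | "H = four_K1" | "H = co_diamond" | "H = co_claw"
      using \<open>H \<in> _\<close> by auto
    then show False
    proof cases
      case 1
      obtain g :: "nat \<Rightarrow> 'a"
        where g: "distinct [g 0, g 1, g 2, g 3]" "{g 0, g 1, g 2, g 3} \<subseteq> pverts ?G"
        and adj: "\<forall>i<4. \<forall>j<4. (g i, g j) \<in> parcs ?G \<longleftrightarrow>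
          (i, j) \<in> {(0, 1), (2, 3)} \<or> (j, i) \<in> {(0, 1), (2, 3)}"
        by (rule induced_copy_four[OF sub iso[unfolded 1 two_K2_def]])
      \<comment> \<open>Agreements along the cycle 0, 2, 1, 3 alternate between \<open>a\<close> and
        \<open>b\<close>, since two consecutive ones under the same map contradict
        \<open>apart\<close>. Each order starts with an agreement under \<open>a\<close>, as
        \<open>simple\<close> requires.\<close>
      have V: "{g 0, g 2, g 1, g 3} \<subseteq> V" "{g 2, g 1, g 3, g 0} \<subseteq> V"
        using g(2) by auto
      have shared: "a (g i) = a (g j) \<or> b (g i) = b (g j)" if "i \<in> {0, 1}" "j \<in> {2, 3}" for i j
        using that g(2) adj[rule_format, of i j] by auto
      have apart: "a (g i) \<noteq> a (g j) \<and> b (g i) \<noteq> b (g j)" if "(i, j) \<in> {(0, 1), (2, 3)}" for i j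
        using that g(2) adj[rule_format, of i j] by auto
      have "a (g 0) = a (g 2) \<or> b (g 0) = b (g 2)"
        by (rule shared) simp_all
      then show False
      proof (elim disjE)
        assume "a (g 0) = a (g 2)"
        moreover from this have "b (g 0) = b (g 3)" "b (g 1) = b (g 2)"
          using shared[of 0 3] shared[of 1 2] apart[of 0 1] apart[of 2 3] by auto
        moreover from this have "a (g 1) = a (g 3)"
          using shared[of 1 3] apart[of 0 1] by auto
        ultimately show False
          using simple[OF V(1)] g(1) by auto
      next
        assume "b (g 0) = b (g 2)"
        moreover from this have "a (g 0) = a (g 3)" "a (g 1) = a (g 2)"
          using shared[of 0 3] shared[of 1 2] apart[of 0 1] apart[of 2 3] by auto
        moreover from this have "b (g 1) = b (g 3)"
          using shared[of 1 3] apart[of 0 1] by auto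
        ultimately show False
          using simple[OF V(2)] g(1) by auto
      qed
    next
      case 2
      obtain g :: "nat \<Rightarrow> 'a"
        where g: "distinct [g 0, g 1, g 2, g 3]" "{g 0, g 1, g 2, g 3} \<subseteq> pverts ?G"
        and adj: "\<forall>i<4. \<forall>j<4. (g i, g j) \<in> parcs ?G \<longleftrightarrow> (i, j) \<in> {} \<or> (j, i) \<in> {}"
        by (rule induced_copy_four[OF sub iso[unfolded 2 four_K1_def]])
      \<comment> \<open>Two triangles sharing 0 and 1 put all four vertices at one value of
        \<open>a\<close>.\<close>
      have "a (g 0) = a (g 1) \<and> a (g 0) = a (g 2)" "a (g 0) = a (g 1) \<and> a (g 0) = a (g 3)"
        by (rule triangle; use g adj[rule_format, of 0 1] adj[rule_format, of 0 2]
          adj[rule_format, of 0 3] adj[rule_format, of 1 2] adj[rule_format, of 1 3] in auto)+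
      then show False
        using a3[of "g 0" "g 1" "g 2" "g 3"] g by auto
    next
      case 3
      obtain g :: "nat \<Rightarrow> 'a"
        where g: "distinct [g 0, g 1, g 2, g 3]" "{g 0, g 1, g 2, g 3} \<subseteq> pverts ?G"
        and adj: "\<forall>i<4. \<forall>j<4. (g i, g j) \<in> parcs ?G \<longleftrightarrow>
          (i, j) \<in> {(0, 1)} \<or> (j, i) \<in> {(0, 1)}"
        by (rule induced_copy_four[OF sub iso[unfolded 3 co_diamond_def]])
      \<comment> \<open>The two triangles through 2 and 3 lie at the same value of \<open>a\<close>,
        so 0 and 1 agree under \<open>a\<close> although they are adjacent.\<close>
      have "a (g 2) = a (g 3) \<and> a (g 2) = a (g 0)" "a (g 2) = a (g 3) \<and> a (g 2) = a (g 1)"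
        by (rule triangle; use g adj[rule_format, of 2 3] adj[rule_format, of 2 0]
          adj[rule_format, of 3 0] adj[rule_format, of 2 1] adj[rule_format, of 3 1] in auto)+
      then show False
        using adj[rule_format, of 0 1] by auto
    next
      case 4
      obtain g :: "nat \<Rightarrow> 'a"
        where g: "distinct [g 0, g 1, g 2, g 3]" "{g 0, g 1, g 2, g 3} \<subseteq> pverts ?G"
        and adj: "\<forall>i<4. \<forall>j<4. (g i, g j) \<in> parcs ?G \<longleftrightarrow>
          (i, j) \<in> {(0, 1), (1, 2), (0, 2)} \<or> (j, i) \<in> {(0, 1), (1, 2), (0, 2)}"
        by (rule induced_copy_four[OF sub iso[unfolded 4 co_claw_def]])
      \<comment> \<open>Two of the three corners agree with the fourth vertex under the same map.\<close>
      show False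
        using g adj[rule_format, of 0 1] adj[rule_format, of 0 2] adj[rule_format, of 1 2]
          adj[rule_format, of 3 0] adj[rule_format, of 3 1] adj[rule_format, of 3 2] by auto
    qed
  qed
  then show ?thesis
    by (auto simp: induced_free_def)
qed

section \<open>Frozen colorings\<close>

text \<open>A path to \<open>d\<close> starts by recoloring a single \<open>v\<close>; some neighbor
  already has the new color and keeps it, a conflict.\<close>

lemma not_mixing_if_frozen:
  assumes c: "c \<in> colorings l G" and d: "d \<in> colorings l G" and "c \<noteq> d"
    and frozen: "\<And>v i. v \<in> pverts G \<Longrightarrow> i \<in> {1..l} \<Longrightarrow> i \<noteq> c v \<Longrightarrow> \<exists>u \<in> pverts G. (v, u) \<in> parcs G \<and> c u = i"
  shows "\<not> mixing l G"
proof
  assume "mixing l G"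
  then have "(c, d) \<in> (parcs (recoloring_graph l G))\<^sup>*"
    using c d by (simp add: mixing_iff)
  then obtain e where "(c, e) \<in> parcs (recoloring_graph l G)"
    using \<open>c \<noteq> d\<close> by (meson converse_rtranclE)
  then have e: "e \<in> colorings l G" and "\<exists>!v. v \<in> pverts G \<and> c v \<noteq> e v"
    by (simp_all add: recoloring_graph_def)
  then obtain v where v: "v \<in> pverts G" "c v \<noteq> e v"
    and only: "\<And>u. u \<in> pverts G \<Longrightarrow> c u \<noteq> e u \<Longrightarrow> u = v"
    by metis
  have "e v \<in> {1..l}"
    using e v(1) by (auto simp: colorings_def)
  then obtain u where "u \<in> pverts G" "(v, u) \<in> parcs G" "c u = e v"
    using frozen[OF v(1)] v(2) by metis
  then show False
    using e only[of u] v(2) by (auto simp: colorings_def)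
qed

lemma not_mixing_separation_graph:
  assumes sep: "\<And>x y. x \<in> V \<Longrightarrow> y \<in> V \<Longrightarrow> a x = a y \<Longrightarrow> b x = b y \<Longrightarrow> x = y"
    and b: "b ` V \<subseteq> {1..l}"
    and two: "\<And>i. i \<in> {1..l} \<Longrightarrow> \<exists>x \<in> V. \<exists>y \<in> V. x \<noteq> y \<and> b x = i \<and> b y = i"
    and a: "a ` V \<subseteq> {1..l}" and "\<exists>x \<in> V. a x \<noteq> b x"
  shows "\<not> mixing l (separation_graph V a b)"
proof (rule not_mixing_if_frozen)
  show "restrict b V \<in> colorings l (separation_graph V a b)"
    "restrict a V \<in> colorings l (separation_graph V a b)"
    using a b by (auto intro!: restrict_in_colorings_separation_graph)
  show "restrict b V \<noteq> restrict a V"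
    using \<open>\<exists>x \<in> V. _\<close> by (metis restrict_apply')
  fix v i
  assume v: "v \<in> pverts (separation_graph V a b)" and i: "i \<in> {1..l}" "i \<noteq> restrict b V v"
  obtain x y where xy: "x \<in> V" "y \<in> V" "x \<noteq> y" "b x = i" "b y = i"
    using two[OF i(1)] by blast
  \<comment> \<open>As \<open>x\<close> and \<open>y\<close> agree under \<open>b\<close>, they
    differ under \<open>a\<close>.\<close>
  then consider "a v \<noteq> a x" | "a v \<noteq> a y"
    using sep by metis
  then show "\<exists>u \<in> pverts (separation_graph V a b).
      (v, u) \<in> parcs (separation_graph V a b) \<and> restrict b V u = i"
    by cases (use xy v i(2) in auto)
qed

section \<open>Disjoint copies of \<open>K_4\<close> minus an edge\<close>

text \<open>The numbers \<open>2 e\<close> and \<open>2 e + 1\<close> stand for the \<open>e\<close>-th edge paired with its two ends; each copy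
  of \<open>K\<^sub>4\<close> minus an edge takes 10 consecutive numbers, for the edges 01, 02, 03, 12, 13 on the vertices 0, 1, 2, 3.\<close>

definition tip :: "nat \<Rightarrow> nat" where
  "tip r = [0, 1, 0, 2, 0, 3, 1, 2, 1, 3] ! r"

text \<open>\<open>Suc\<close> because colors start at 1.\<close>

definition vertex_of :: "nat \<Rightarrow> nat" where
  "vertex_of x = Suc (4 * (x div 10) + tip (x mod 10))"

definition edge_of :: "nat \<Rightarrow> nat" where
  "edge_of x = Suc (x div 2)"

lemma less_10_cases:
  assumes "(r::nat) < 10"
  shows "r \<in> {0, 1, 2, 3, 4, 5, 6, 7, 8, 9}"
  using assms by auto

lemma tip_less: "r < 10 \<Longrightarrow> tip r < 4"
  by (drule less_10_cases) (auto simp: tip_def)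

text \<open>Splitting into copy and residue leaves only finite checks on ten residues.\<close>

lemma vertex_of_eq_iff:
  "vertex_of x = vertex_of y \<longleftrightarrow> x div 10 = y div 10 \<and> tip (x mod 10) = tip (y mod 10)"
proof -
  have "4 * q + r = 4 * q' + r' \<longleftrightarrow> q = q' \<and> r = r'" if "r < 4" "r' < 4" for q q' r r' :: nat
    using that by presburger
  then show ?thesis
    by (simp add: vertex_of_def tip_less)
qed

lemma edge_of_eq_iff:
  "edge_of x = edge_of y \<longleftrightarrow> x div 10 = y div 10 \<and> (x mod 10) div 2 = (y mod 10) div 2"
proof -
  have split: "edge_of (10 * q + r) = Suc (5 * q + r div 2)" for q r
    unfolding edge_of_def by presburger
  have "5 * q + r = 5 * q' + r' \<longleftrightarrow> q = q' \<and> r = r'" if "r < 5" "r' < 5" for q q' r r' :: nat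
    using that by presburger
  moreover have "u mod 10 div 2 < 5" for u :: nat
    by simp
  ultimately show ?thesis
    using split[of "x div 10" "x mod 10"] split[of "y div 10" "y mod 10"] by simp
qed

lemma eq_iff_div_mod_10: "x = y \<longleftrightarrow> x div 10 = y div 10 \<and> x mod 10 = y mod (10::nat)"
  by (metis div_mult_mod_eq)

lemma tip_inj:
  assumes "r < 10" "s < 10" and "tip r = tip s" "r div 2 = s div 2"
  shows "r = s"
proof -
  have "\<forall>u \<in> {0, 1, 2, 3, 4, 5, 6, 7, 8, 9}. \<forall>v \<in> {0, 1, 2, 3, 4, 5, 6, 7, 8, 9}.
      tip u = tip v \<longrightarrow> u div 2 = v div 2 \<longrightarrow> u = v"
    by (simp add: tip_def)
  from this[THEN bspec, OF less_10_cases[OF assms(1)], THEN bspec, OF less_10_cases[OF assms(2)]]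
  show ?thesis
    using assms(3,4) by simp
qed

lemma vertex_edge_inj:
  assumes "vertex_of x = vertex_of y" and "edge_of x = edge_of y"
  shows "x = y"
  using assms tip_inj[of "x mod 10" "y mod 10"]
  by (simp add: vertex_of_eq_iff edge_of_eq_iff eq_iff_div_mod_10[of x y])

text \<open>Pigeonhole on parity: an edge has only two ends.\<close>

lemma edge_of_fibre:
  assumes "edge_of x = edge_of y" and "edge_of x = edge_of z"
  shows "\<not> distinct [x, y, z]"
proof -
  have "x mod 2 = y mod 2 \<or> x mod 2 = z mod 2 \<or> y mod 2 = z mod 2"
    by (cases "even x"; cases "even y"; cases "even z") (simp_all add: even_iff_mod_2_eq_zero)
  moreover have "x div 2 = y div 2" "x div 2 = z div 2"
    using assms by (simp_all add: edge_of_def)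
  ultimately have "x = y \<or> x = z \<or> y = z"
    by (metis mult_div_mod_eq)
  then show ?thesis
    by auto
qed

text \<open>The lists are the positions of 0, 1, 2, 3 in the list defining
  \<open>tip\<close>.\<close>

lemma tip_fibre:
  assumes "r < 10"
  shows "r \<in> set ([[0, 2, 4], [1, 6, 8], [3, 7], [5, 9]] ! tip r)"
  using less_10_cases[OF assms] by (auto simp: tip_def)

text \<open>Maximum degree 3: within one copy the residues are distinct, and each list of positions
  has at most three entries.\<close>

lemma vertex_of_fibre:
  assumes "vertex_of w = vertex_of x" "vertex_of w = vertex_of y" "vertex_of w = vertex_of z"
  shows "\<not> distinct [w, x, y, z]"
proof
  assume dist: "distinct [w, x, y, z]"
  define L :: "nat list" where "L = [[0, 2, 4], [1, 6, 8], [3, 7], [5, 9]] ! tip (w mod 10)"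
  have same: "u div 10 = w div 10" "u mod 10 \<in> set L" if "u \<in> {w, x, y, z}" for u
    using that assms tip_fibre[of "u mod 10"] by (auto simp: vertex_of_eq_iff L_def)
  have "inj_on (\<lambda>u. u mod 10) {w, x, y, z}"
    by (rule inj_onI) (metis same(1) eq_iff_div_mod_10)
  then have "card {w, x, y, z} \<le> card (set L)"
    by (rule card_inj_on_le) (use same(2) in auto)
  also have "\<dots> \<le> length L"
    by (rule card_length)
  also have "\<dots> \<le> 3"
  proof -
    have "tip (w mod 10) \<in> {0, 1, 2, 3}"
      using tip_less[of "w mod 10"] by auto
    then show ?thesis
      by (auto simp: L_def)
  qed
  finally show False
    using dist by simp
qed

text \<open>No two edges have the same pair of ends.\<close>

lemma tip_simple:
  assumes "q < 10" "r < 10"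
    and "tip q = tip r" "r div 2 = s div 2" "tip s = tip t" "t div 2 = q div 2"
  shows "q = r \<or> r = s"
proof -
  \<comment> \<open>The opposite end of the same edge: swaps \<open>2 * e\<close> and
    \<open>2 * e + 1\<close>.\<close>
  define other :: "nat \<Rightarrow> nat" where "other u = 2 * (u div 2) + (1 - u mod 2)" for u
  have "u = v \<or> u = other v" if "u div 2 = v div 2" for u v
  proof -
    have "u mod 2 = v mod 2 \<or> u mod 2 = 1 - v mod 2"
      by (cases "even u"; cases "even v") (simp_all add: odd_iff_mod_2_eq_one even_iff_mod_2_eq_zero)
    then show ?thesis
      unfolding other_def by (metis that mult_div_mod_eq)
  qed
  from this[OF assms(4)[symmetric]] this[OF assms(6)]
  have st: "r = s \<or> s = other r" "t = q \<or> t = other q"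
    by auto
  have "\<forall>u \<in> {0, 1, 2, 3, 4, 5, 6, 7, 8, 9}. tip u \<noteq> tip (other u)"
    by (simp add: other_def tip_def)
  then have loopfree: "tip r \<noteq> tip (other r)"
    using less_10_cases[OF assms(2)] by (rule bspec)
  have "\<forall>u \<in> {0, 1, 2, 3, 4, 5, 6, 7, 8, 9}. \<forall>v \<in> {0, 1, 2, 3, 4, 5, 6, 7, 8, 9}.
      tip u = tip v \<longrightarrow> tip (other v) = tip (other u) \<longrightarrow> u = v"
    by (simp add: other_def tip_def)
  from this[THEN bspec, OF less_10_cases[OF assms(1)], THEN bspec, OF less_10_cases[OF assms(2)]]
  have "tip (other r) = tip (other q) \<Longrightarrow> q = r"
    using assms(3) by simp
  \<comment> \<open>If \<open>s = other r\<close>, then \<open>t = q\<close> would make the edge of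
    \<open>r\<close> a loop, and \<open>t = other q\<close> gives two edges with equal ends.\<close>
  then show ?thesis
    using st assms(3,5) loopfree by auto
qed

text \<open>Each agreement stays within one copy, so \<open>tip_simple\<close> applies to the
  residues.\<close>

lemma vertex_edge_simple:
  assumes "vertex_of w = vertex_of x" "edge_of x = edge_of y" "vertex_of y = vertex_of z"
    "edge_of z = edge_of w"
  shows "\<not> distinct [w, x, y, z]"
proof -
  have "w mod 10 = x mod 10 \<or> x mod 10 = y mod 10"
    by (rule tip_simple[of _ _ _ "z mod 10"])
      (use assms in \<open>simp_all add: vertex_of_eq_iff edge_of_eq_iff\<close>)
  moreover have "w div 10 = x div 10" "x div 10 = y div 10"
    using assms(1,2) by (simp_all add: vertex_of_eq_iff edge_of_eq_iff)
  ultimately have "w = x \<or> x = y"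
    by (metis eq_iff_div_mod_10)
  then show ?thesis
    by auto
qed

theorem theorem13:
  fixes p :: nat
  assumes "p \<ge> 1"
  shows "\<exists>k::nat. k \<ge> 1 \<and> (\<exists>G :: nat pair_pre_digraph.
    pair_graph G \<and>
    colorable k G \<and>
    induced_free {two_K2, four_K1, co_diamond, co_claw} G \<and>
    \<not> mixing (k + p) G)"
proof (intro exI conjI)
  \<comment> \<open>\<open>p\<close> copies have \<open>4 * p\<close> vertices, which is
    \<open>k\<close>, and \<open>5 * p\<close> edges with \<open>10 * p\<close> ends.\<close>
  let ?V = "{..<10 * p}"
  let ?G = "separation_graph ?V vertex_of edge_of"
  have range_a: "vertex_of ` ?V \<subseteq> {1..4 * p}"
  proof (intro subsetI, elim imageE)
    fix v x assume "v = vertex_of x" and "x \<in> ?V"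
    moreover from \<open>x \<in> ?V\<close> have "x div 10 < p"
      by auto
    ultimately show "v \<in> {1..4 * p}"
      using tip_less[of "x mod 10"] by (simp add: vertex_of_def)
  qed
  show "4 * p \<ge> 1"
    using assms by simp
  show "pair_graph ?G"
    by (simp add: pair_graph_separation_graph)
  show "colorable (4 * p) ?G"
    using restrict_in_colorings_separation_graph[OF _ range_a] by (auto simp: colorable_def)
  show "induced_free {two_K2, four_K1, co_diamond, co_claw} ?G"
    by (rule induced_free_separation_graph)
      (metis vertex_edge_inj, metis edge_of_fibre, metis vertex_of_fibre, metis vertex_edge_simple)
  show "\<not> mixing (4 * p + p) ?G"
  proof (rule not_mixing_separation_graph)
    show "edge_of ` ?V \<subseteq> {1..4 * p + p}"
      by (auto simp: edge_of_def)
    show "vertex_of ` ?V \<subseteq> {1..4 * p + p}"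
      using range_a by auto
    \<comment> \<open>At 0 both maps give 1; at 1 they give 2 and 1.\<close>
    show "\<exists>x \<in> ?V. vertex_of x \<noteq> edge_of x"
      by (rule bexI[of _ 1]) (use assms in \<open>auto simp: vertex_of_def edge_of_def tip_def\<close>)
    \<comment> \<open>Color \<open>i\<close> belongs to edge \<open>i - 1\<close>, counted from 0;
      the witnesses are its two ends.\<close>
    show "\<exists>x \<in> ?V. \<exists>y \<in> ?V. x \<noteq> y \<and> edge_of x = i \<and> edge_of y = i" if "i \<in> {1..4 * p + p}" for i
      by (rule bexI[of _ "2 * (i - 1)"], rule bexI[of _ "2 * (i - 1) + 1"])
        (use that in \<open>auto simp: edge_of_def\<close>)
  qed (rule vertex_edge_inj)
qed

end
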